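(* Let $(C_n,\mathbf{w})$ and $(C_m,\mathbf{w}')$ be weighted cycles ($n,m\ge 3$) with edge weights $w_1,\dots,w_n$ and $w'_1,\dots,w'_m$ respectively, such that at least one of $\sum_{i=1}^n w_i$ and $\sum_{i=1}^m w'_i$ is even. Then $c\big(C_n\square C_m,\mathbf{w}\square\mathbf{w}'\big)=c(C_n,\mathbf{w})+c(C_m,\mathbf{w}')$.
   Context: A weighted graph is a finite simple graph with positive integer edge weights that is weight-minimal: every edge is a shortest path between its endpoints. $d_\mathbf{w}$ is the weighted shortest-path distance. A binary addressing of length $m$ is a map $f:V\to\{0,1\}^m$ with $d_\mathbf{w}(u,v)\le d_H(f(u),f(v))$ for all $u,v$ ($d_H$ Hamming distance); $c(G,\mathbf{w})$ is the minimum such $m$. The weighted Cartesian product $(G_1\square G_2,\mathbf{w}_1\square\mathbf{w}_2)$ has vertex set $V(G_1)\times V(G_2)$; $(u,x)$ and $(v,x)$ are joined by an edge of weight $\mathbf{w}_1(uv)$ when $uv\in E(G_1)$, and $(u,x)$ and $(u,y)$ by an edge of weight $\mathbf{w}_2(xy)$ when $xy\in E(G_2)$. *)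

theory Defs
  imports Main "HOL-Library.Extended_Nat"
begin

record 'a wgraph =
  verts :: "'a set"
  edges :: "'a set set"
  weight :: "'a set \<Rightarrow> nat"

definition is_path :: "('a, 'b) wgraph_scheme \<Rightarrow> 'a \<Rightarrow> 'a list \<Rightarrow> 'a \<Rightarrow> bool" where
  "is_path G u p v \<longleftrightarrow>
     p \<noteq> [] \<and> hd p = u \<and> last p = v \<and> distinct p \<and> set p \<subseteq> verts G \<and>
     successively (\<lambda>x y. {x, y} \<in> edges G) p"

definition path_weight :: "('a, 'b) wgraph_scheme \<Rightarrow> 'a list \<Rightarrow> nat" where
  "path_weight G p = (\<Sum>i<length p - 1. weight G {p ! i, p ! Suc i})"

text \<open>Vertices not joined by any path are at distance \<open>\<infinity>\<close>.\<close>

definition wdist :: "('a, 'b) wgraph_scheme \<Rightarrow> 'a \<Rightarrow> 'a \<Rightarrow> enat" where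
  "wdist G u v = (INF p \<in> {p. is_path G u p v}. enat (path_weight G p))"

text \<open>The last conjunct is weight-minimality. The values of \<^const>\<open>weight\<close> on sets that are
  not edges are irrelevant.\<close>

definition weighted_graph :: "('a, 'b) wgraph_scheme \<Rightarrow> bool" where
  "weighted_graph G \<longleftrightarrow>
     finite (verts G) \<and>
     (\<forall>e\<in>edges G. e \<subseteq> verts G \<and> card e = 2) \<and>
     (\<forall>e\<in>edges G. weight G e > 0) \<and>
     (\<forall>u v. {u, v} \<in> edges G \<longrightarrow> wdist G u v = enat (weight G {u, v}))"

definition hamming_dist :: "bool list \<Rightarrow> bool list \<Rightarrow> nat" where
  "hamming_dist xs ys = card {i. i < length xs \<and> xs ! i \<noteq> ys ! i}"

definition binary_addressing :: "('a, 'b) wgraph_scheme \<Rightarrow> nat \<Rightarrow> ('a \<Rightarrow> bool list) \<Rightarrow> bool" where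
  "binary_addressing G m f \<longleftrightarrow>
     (\<forall>u\<in>verts G. length (f u) = m) \<and>
     (\<forall>u\<in>verts G. \<forall>v\<in>verts G. wdist G u v \<le> enat (hamming_dist (f u) (f v)))"

text \<open>An addressing exists for every finite connected graph, so the least length is well defined
  there.\<close>

definition addressing_number :: "('a, 'b) wgraph_scheme \<Rightarrow> nat" where
  "addressing_number G = (LEAST m. \<exists>f. binary_addressing G m f)"

text \<open>On an edge \<open>{(u, x), (v, x)}\<close> the second projection is the singleton \<open>{x}\<close> and the first is
  the edge \<open>{u, v}\<close>; on an edge \<open>{(u, x), (u, y)}\<close> the second projection is the edge \<open>{x, y}\<close>,
  which has two elements. This is how the weight tells the two kinds of edges apart.\<close>

definition cart_prod :: "'a wgraph \<Rightarrow> 'b wgraph \<Rightarrow> ('a \<times> 'b) wgraph" where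
  "cart_prod G H =
     \<lparr>verts = verts G \<times> verts H,
      edges = {{(u, x), (v, x)} | u v x. {u, v} \<in> edges G \<and> x \<in> verts H} \<union>
              {{(u, x), (u, y)} | u x y. u \<in> verts G \<and> {x, y} \<in> edges H},
      weight = (\<lambda>e. if is_singleton (snd ` e) then weight G (fst ` e) else weight H (snd ` e))\<rparr>"

text \<open>For \<open>n \<ge> 3\<close> this is the cycle on \<open>n\<close> vertices, with \<open>n\<close> distinct edges.\<close>

definition cycle :: "nat \<Rightarrow> (nat set \<Rightarrow> nat) \<Rightarrow> nat wgraph" where
  "cycle n w =
     \<lparr>verts = {..<n}, edges = {{i, Suc i mod n} | i. i < n}, weight = w\<rparr>"

end

theory Submission imports Defs begin

text \<open>Writing \<open>W\<close> for the total weight of a cycle, \<open>c = \<lceil>W / 2\<rceil>\<close>: the cycle embeds into an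
  unweighted cycle of length \<open>2 \<lceil>W / 2\<rceil>\<close>, hence into a hypercube of dimension \<open>\<lceil>W / 2\<rceil>\<close>.
  Conversely, weight-minimality yields three vertices cutting the cycle into arcs of weight at most
  \<open>W / 2\<close>, so their pairwise distances sum to \<open>W\<close>, whereas three binary words of length \<open>k\<close> have
  pairwise Hamming distances summing to at most \<open>2 k\<close>. Pairing such triples in the two factors gives
  three vertices of the product with distances summing to \<open>W + W'\<close>, and
  \<open>\<lceil>(W + W') / 2\<rceil> = \<lceil>W / 2\<rceil> + \<lceil>W' / 2\<rceil>\<close> unless both are odd. The upper bound for the product
  concatenates addressings.\<close>

section \<open>Path weights, walks and the weighted distance\<close>

lemma path_weight_simps [simp]:
  "path_weight G [] = 0"
  "path_weight G [x] = 0"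
  "path_weight G (x # y # p) = weight G {x, y} + path_weight G (y # p)"
  unfolding path_weight_def
  by (simp_all add: sum.lessThan_Suc_shift del: sum.lessThan_Suc)

lemma path_weight_append:
  "path_weight G (p @ x # q) = path_weight G (p @ [x]) + path_weight G (x # q)"
proof (induction p)
  case (Cons a p)
  then show ?case by (cases p) auto
qed simp

lemma path_weight_rev: "path_weight G (rev p) = path_weight G p"
proof (induction p)
  case (Cons a p)
  then show ?case
    by (cases p) (auto simp: path_weight_append[of G _ _ "[a]"] insert_commute)
qed simp

text \<open>Concatenating two paths may repeat vertices, so upper bounds on \<open>wdist\<close> are
  proved with walks, which may revisit a vertex.\<close>

definition is_walk :: "('a, 'b) wgraph_scheme \<Rightarrow> 'a \<Rightarrow> 'a list \<Rightarrow> 'a \<Rightarrow> bool" where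
  "is_walk G u p v \<longleftrightarrow>
     p \<noteq> [] \<and> hd p = u \<and> last p = v \<and> set p \<subseteq> verts G \<and>
     successively (\<lambda>x y. {x, y} \<in> edges G) p"

lemma is_path_iff_walk: "is_path G u p v \<longleftrightarrow> is_walk G u p v \<and> distinct p"
  unfolding is_path_def is_walk_def by auto

text \<open>Cutting out the closed section between two occurrences of a vertex shortens a walk
  without increasing its weight; repeating this ends in a path.\<close>

lemma wdist_le_walk_weight:
  assumes "is_walk G u p v"
  shows "wdist G u v \<le> enat (path_weight G p)"
  using assms
proof (induction p rule: length_induct)
  case (1 p)
  show ?case
  proof (cases "distinct p")
    case True
    with 1 show ?thesis
      unfolding wdist_def by (intro INF_lower) (simp add: is_path_iff_walk)
  next
    case False
    then obtain a y b c where p: "p = a @ [y] @ b @ [y] @ c"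
      using not_distinct_decomp by blast
    have "is_walk G u (a @ y # c) v"
      using "1.prems" unfolding p is_walk_def
      by (auto simp: successively_append_iff successively_Cons hd_append split: if_splits)
    then have "wdist G u v \<le> enat (path_weight G (a @ y # c))"
      using "1.IH" by (simp add: p)
    also have "path_weight G (a @ y # c) \<le> path_weight G p"
      using path_weight_append[of G a y c] path_weight_append[of G a y "b @ y # c"]
        path_weight_append[of G "y # b" y c]
      by (simp add: p)
    finally show ?thesis by simp
  qed
qed

lemma wdist_attained:
  assumes "wdist G u v \<noteq> \<infinity>"
  obtains p where "is_path G u p v" "wdist G u v = enat (path_weight G p)"
proof -
  let ?A = "(\<lambda>p. enat (path_weight G p)) ` {p. is_path G u p v}"
  have "?A \<noteq> {}"
    using assms unfolding wdist_def by (metis Inf_empty top_enat_def)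
  then have "Inf ?A \<in> ?A"
    by (meson wellorder_InfI ex_in_conv)
  then show thesis
    using that unfolding wdist_def by auto
qed

lemma wdist_triangle: "wdist G u v \<le> wdist G u x + wdist G x v"
proof (cases "wdist G u x = \<infinity> \<or> wdist G x v = \<infinity>")
  case False
  obtain p where p: "is_path G u p x" "wdist G u x = enat (path_weight G p)"
    using False wdist_attained[of G u x] by blast
  obtain q where q: "is_path G x q v" "wdist G x v = enat (path_weight G q)"
    using False wdist_attained[of G x v] by blast
  obtain p' where p': "p = p' @ [x]"
    using p(1) unfolding is_path_def by (metis append_butlast_last_id)
  obtain q' where q': "q = x # q'"
    using q(1) unfolding is_path_def by (metis list.collapse)
  have "is_walk G u (p' @ x # q') v"
    using p(1) q(1) unfolding is_path_def is_walk_def p' q'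
    by (auto simp: successively_append_iff successively_Cons hd_append split: if_splits)
  from wdist_le_walk_weight[OF this] show ?thesis
    by (simp add: p(2) q(2) p' q' path_weight_append[of G p' x q'])
qed auto

lemma wdist_commute: "wdist G u v = wdist G v u"
proof -
  have "wdist G u v \<le> wdist G v u" for u v
  proof (cases "wdist G v u = \<infinity>")
    case False
    then obtain p where p: "is_path G v p u" "wdist G v u = enat (path_weight G p)"
      by (rule wdist_attained)
    have "is_walk G u (rev p) v"
      using p(1) unfolding is_path_def is_walk_def
      by (auto simp: hd_rev last_rev insert_commute)
    from wdist_le_walk_weight[OF this] show ?thesis
      by (simp add: p(2) path_weight_rev)
  qed simp
  then show ?thesis by (meson order_antisym)
qed

lemma wdist_self:
  assumes "u \<in> verts G"
  shows "wdist G u u = 0"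
proof -
  have "is_walk G u [u] u" using assms by (simp add: is_walk_def)
  from wdist_le_walk_weight[OF this] show ?thesis by (simp add: zero_enat_def[symmetric])
qed

lemma wdist_edge_le:
  assumes "{u, v} \<in> edges G" "u \<in> verts G" "v \<in> verts G"
  shows "wdist G u v \<le> enat (weight G {u, v})"
proof -
  have "is_walk G u [u, v] v" using assms by (simp add: is_walk_def)
  from wdist_le_walk_weight[OF this] show ?thesis by simp
qed

section \<open>Lower bounds for the weighted distance\<close>

definition edge_dominated :: "('a, 'b) wgraph_scheme \<Rightarrow> ('a \<Rightarrow> 'a \<Rightarrow> nat) \<Rightarrow> bool" where
  "edge_dominated G d \<longleftrightarrow>
     (\<forall>u\<in>verts G. d u u = 0) \<and>
     (\<forall>u\<in>verts G. \<forall>v\<in>verts G. \<forall>x\<in>verts G. d u v \<le> d u x + d x v) \<and>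
     (\<forall>u\<in>verts G. \<forall>v\<in>verts G. {u, v} \<in> edges G \<longrightarrow> d u v \<le> weight G {u, v})"

text \<open>The triangle inequality summed along a walk bounds \<open>d u v\<close> by the weight of
  the walk. This certifies lower bounds on \<open>wdist\<close> without examining all paths.\<close>

lemma edge_dominated_le_wdist:
  assumes d: "edge_dominated G d"
  shows "enat (d u v) \<le> wdist G u v"
proof -
  have "d u v \<le> path_weight G p" if "is_walk G u p v" for u p
    using that
  proof (induction p arbitrary: u)
    case Nil
    then show ?case by (simp add: is_walk_def)
  next
    case (Cons a p)
    show ?case
    proof (cases p)
      case Nil
      with Cons.prems d show ?thesis
        by (auto simp: is_walk_def edge_dominated_def)
    next
      case (Cons b q)
      with Cons.prems have u: "a = u" and e: "{u, b} \<in> edges G"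
        and V: "u \<in> verts G" "b \<in> verts G" "v \<in> verts G" and w: "is_walk G b p v"
        by (auto simp: is_walk_def split: if_splits)
      have "d u v \<le> d u b + d b v" "d u b \<le> weight G {u, b}"
        using d e V unfolding edge_dominated_def by blast+
      with Cons.IH[OF w] show ?thesis by (simp add: Cons u)
    qed
  qed
  then show ?thesis
    unfolding wdist_def by (auto intro!: INF_greatest simp: is_path_iff_walk)
qed

section \<open>Hamming distance and the perimeter bound\<close>

lemma hamming_dist_sum:
  "hamming_dist xs ys = (\<Sum>i<length xs. of_bool (xs ! i \<noteq> ys ! i))"
  unfolding hamming_dist_def by (auto simp: Int_def intro!: arg_cong[where f = card])

lemma hamming_dist_append:
  assumes "length xs = length xs'"
  shows "hamming_dist (xs @ ys) (xs' @ ys') = hamming_dist xs xs' + hamming_dist ys ys'"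
proof -
  let ?g = "\<lambda>i. of_bool ((xs @ ys) ! i \<noteq> (xs' @ ys') ! i) :: nat"
  have "sum ?g {..<length xs + length ys} =
      sum ?g {..<length xs} + sum ?g {length xs..<length ys + length xs}"
    using sum.atLeastLessThan_concat[of 0 "length xs" "length ys + length xs" ?g]
    unfolding lessThan_atLeast0 add.commute[of "length xs"] by linarith
  also have "sum ?g {..<length xs} = hamming_dist xs xs'"
    using assms by (auto simp: hamming_dist_sum nth_append intro!: sum.cong)
  also have "sum ?g {length xs..<length ys + length xs} =
      (\<Sum>i<length ys. ?g (i + length xs))"
    using sum.shift_bounds_nat_ivl[of ?g 0 "length xs" "length ys"]
    by (simp add: lessThan_atLeast0)
  also have "\<dots> = hamming_dist ys ys'"
    using assms by (simp add: hamming_dist_sum nth_append)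
  finally show ?thesis by (simp add: hamming_dist_sum)
qed

text \<open>Among three bits at most two of the three pairs disagree, so each coordinate contributes
  at most 2.\<close>

lemma hamming_dist_triangle_perimeter:
  assumes "length xs = k" "length ys = k" "length zs = k"
  shows "hamming_dist xs ys + hamming_dist ys zs + hamming_dist zs xs \<le> 2 * k"
proof -
  have "hamming_dist xs ys + hamming_dist ys zs + hamming_dist zs xs =
      (\<Sum>i<k. of_bool (xs ! i \<noteq> ys ! i) + of_bool (ys ! i \<noteq> zs ! i) + of_bool (zs ! i \<noteq> xs ! i))"
    using assms by (simp add: hamming_dist_sum sum.distrib)
  also have "\<dots> \<le> (\<Sum>i<k. 2)"
    by (intro sum_mono) auto
  finally show ?thesis by simp
qed

text \<open>The source of all lower bounds on address lengths below: a triple of large perimeter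
  forces long addresses.\<close>

lemma binary_addressing_perimeter:
  assumes f: "binary_addressing G k f" and d: "edge_dominated G d"
    and V: "a \<in> verts G" "b \<in> verts G" "c \<in> verts G"
  shows "d a b + d b c + d c a \<le> 2 * k"
proof -
  have "d u v \<le> hamming_dist (f u) (f v)" if "u \<in> verts G" "v \<in> verts G" for u v
    using edge_dominated_le_wdist[OF d, of u v] f that
    unfolding binary_addressing_def by (meson enat_ord_simps(1) order_trans)
  then have "d a b + d b c + d c a \<le>
      hamming_dist (f a) (f b) + hamming_dist (f b) (f c) + hamming_dist (f c) (f a)"
    using V by (simp add: add_mono)
  also have "\<dots> \<le> 2 * k"
    using f V unfolding binary_addressing_def by (intro hamming_dist_triangle_perimeter) auto
  finally show ?thesis .
qed

section \<open>Cartesian products\<close>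

lemma cart_prod_weight [simp]:
  "weight (cart_prod G H) {(u, x), (v, x)} = weight G {u, v}"
  "x \<noteq> y \<Longrightarrow> weight (cart_prod G H) {(u, x), (u, y)} = weight H {x, y}"
  by (auto simp: cart_prod_def is_singleton_def)

lemma verts_cart_prod [simp]: "verts (cart_prod G H) = verts G \<times> verts H"
  by (simp add: cart_prod_def)

lemma edges_cart_prodI:
  "{u, v} \<in> edges G \<Longrightarrow> x \<in> verts H \<Longrightarrow> {(u, x), (v, x)} \<in> edges (cart_prod G H)"
  "{x, y} \<in> edges H \<Longrightarrow> u \<in> verts G \<Longrightarrow> {(u, x), (u, y)} \<in> edges (cart_prod G H)"
  by (auto simp: cart_prod_def)

lemma edges_cart_prodE:
  assumes "{(u, x), (v, y)} \<in> edges (cart_prod G H)"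
  obtains "x = y" "{u, v} \<in> edges G" | "u = v" "{x, y} \<in> edges H"
  using assms by (auto simp: cart_prod_def doubleton_eq_iff insert_commute)

lemma weighted_graph_edge_neq:
  assumes "weighted_graph G" "{u, v} \<in> edges G"
  shows "u \<noteq> v"
  using assms unfolding weighted_graph_def by fastforce

lemma edge_dominated_cart_prod:
  assumes G: "edge_dominated G d" and H: "edge_dominated H d'" and wH: "weighted_graph H"
  shows "edge_dominated (cart_prod G H) (\<lambda>(u, x) (v, y). d u v + d' x y)"
  unfolding edge_dominated_def
proof (intro conjI ballI impI; clarsimp)
  fix u x assume "u \<in> verts G" "x \<in> verts H"
  then show "d u u = 0 \<and> d' x x = 0"
    using G H by (auto simp: edge_dominated_def)
next
  fix u x v y z t
  assume "u \<in> verts G" "x \<in> verts H" "v \<in> verts G" "y \<in> verts H" "z \<in> verts G" "t \<in> verts H"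
  then have "d u v \<le> d u z + d z v" "d' x y \<le> d' x t + d' t y"
    using G H by (auto simp: edge_dominated_def)
  then show "d u v + d' x y \<le> d u z + d' x t + (d z v + d' t y)" by simp
next
  fix u x v y
  assume V: "u \<in> verts G" "x \<in> verts H" "v \<in> verts G" "y \<in> verts H"
    and "{(u, x), (v, y)} \<in> edges (cart_prod G H)"
  from this(5) show "d u v + d' x y \<le> weight (cart_prod G H) {(u, x), (v, y)}"
  proof (cases rule: edges_cart_prodE)
    case 1
    with G H V show ?thesis by (auto simp: edge_dominated_def)
  next
    case 2
    \<comment> \<open>If \<open>x = y\<close>, the second projection would be a singleton and the
      weight would be read from \<open>G\<close>.\<close>
    with weighted_graph_edge_neq[OF wH] have "x \<noteq> y" by blast
    with 2 G H V show ?thesis by (auto simp: edge_dominated_def)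
  qed
qed

text \<open>A shortest path of \<open>G\<close> is copied into the layer at height
  \<open>x\<close>.\<close>

lemma wdist_cart_prod_le1:
  assumes "x \<in> verts H"
  shows "wdist (cart_prod G H) (u, x) (v, x) \<le> wdist G u v"
proof (cases "wdist G u v = \<infinity>")
  case False
  then obtain p where p: "is_path G u p v" "wdist G u v = enat (path_weight G p)"
    by (rule wdist_attained)
  have "is_walk (cart_prod G H) (u, x) (map (\<lambda>a. (a, x)) p) (v, x)"
    using p(1) assms unfolding is_path_def is_walk_def
    by (auto simp: successively_map hd_map last_map edges_cart_prodI elim!: successively_mono)
  moreover have "path_weight (cart_prod G H) (map (\<lambda>a. (a, x)) p) = path_weight G p"
    by (induction p rule: induct_list012) auto
  ultimately show ?thesis
    using wdist_le_walk_weight p(2) by metis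
qed simp

lemma wdist_cart_prod_le2:
  assumes "u \<in> verts G" and H: "weighted_graph H"
  shows "wdist (cart_prod G H) (u, x) (u, y) \<le> wdist H x y"
proof (cases "wdist H x y = \<infinity>")
  case False
  then obtain p where p: "is_path H x p y" "wdist H x y = enat (path_weight H p)"
    by (rule wdist_attained)
  have "is_walk (cart_prod G H) (u, x) (map (Pair u) p) (u, y)"
    using p(1) assms unfolding is_path_def is_walk_def
    by (auto simp: successively_map hd_map last_map edges_cart_prodI elim!: successively_mono)
  \<comment> \<open>Consecutive vertices of \<open>p\<close> must differ for the weight of the
    copied edge to be read from \<open>H\<close>.\<close>
  moreover have "distinct p" using p(1) by (simp add: is_path_def)
  then have "path_weight (cart_prod G H) (map (Pair u) p) = path_weight H p"
    by (induction p rule: induct_list012) auto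
  ultimately show ?thesis
    using wdist_le_walk_weight p(2) by metis
qed simp

text \<open>Distances in the product are at most the sum of the distances in the factors, by moving
  first in \<open>G\<close> and then in \<open>H\<close>, while Hamming distances add under
  concatenation.\<close>

lemma binary_addressing_cart_prod:
  assumes f: "binary_addressing G k f" and g: "binary_addressing H l g" and H: "weighted_graph H"
  shows "binary_addressing (cart_prod G H) (k + l) (\<lambda>(u, x). f u @ g x)"
  unfolding binary_addressing_def
proof (intro conjI ballI; clarsimp)
  fix u x assume "u \<in> verts G" "x \<in> verts H"
  then show "length (f u) + length (g x) = k + l"
    using f g by (simp add: binary_addressing_def)
next
  fix u x v y
  assume V: "u \<in> verts G" "x \<in> verts H" "v \<in> verts G" "y \<in> verts H"
  have "wdist (cart_prod G H) (u, x) (v, y) \<le>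
      wdist (cart_prod G H) (u, x) (v, x) + wdist (cart_prod G H) (v, x) (v, y)"
    by (rule wdist_triangle)
  also have "\<dots> \<le> wdist G u v + wdist H x y"
    by (intro add_mono wdist_cart_prod_le1 wdist_cart_prod_le2 V H)
  also have "\<dots> \<le> enat (hamming_dist (f u) (f v)) + enat (hamming_dist (g x) (g y))"
    using f g V by (intro add_mono) (auto simp: binary_addressing_def)
  also have "\<dots> = enat (hamming_dist (f u @ g x) (f v @ g y))"
    using f V by (simp add: binary_addressing_def hamming_dist_append)
  finally show "wdist (cart_prod G H) (u, x) (v, y) \<le> enat (hamming_dist (f u @ g x) (f v @ g y))" .
qed

section \<open>The circle and its embedding into a hypercube\<close>

text \<open>The distance on a circle of circumference \<open>W\<close>; one of the two truncated differences is 0.\<close>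

definition circ_dist :: "nat \<Rightarrow> nat \<Rightarrow> nat \<Rightarrow> nat" where
  "circ_dist W a b = min ((a - b) + (b - a)) (W - ((a - b) + (b - a)))"

lemma circ_dist_triangle:
  assumes "a \<le> W" "b \<le> W" "c \<le> W"
  shows "circ_dist W a b \<le> circ_dist W a c + circ_dist W c b"
proof -
  define x y z where "x = (a - b) + (b - a)" and "y = (a - c) + (c - a)" and "z = (c - b) + (b - c)"
  have "x \<le> y + z" "y \<le> x + z" "z \<le> x + y"
    unfolding x_def y_def z_def by linarith+
  \<comment> \<open>This covers the case where both minima on the right of the goal are taken the
    long way round.\<close>
  moreover have "x + y + z \<le> 2 * W"
    using assms unfolding x_def y_def z_def by linarith
  ultimately have "min x (W - x) \<le> min y (W - y) + min z (W - z)"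
    by linarith
  then show ?thesis
    by (simp add: circ_dist_def x_def y_def z_def)
qed

text \<open>The image of \<open>p\<close> under the isometric embedding of the cycle of length \<open>2 k\<close> into the
  \<open>k\<close>-cube: coordinate \<open>i\<close> is switched on at step \<open>i + 1\<close> and off at step \<open>i + k + 1\<close>.\<close>

definition cycle_code :: "nat \<Rightarrow> nat \<Rightarrow> bool list" where
  "cycle_code k p = map (\<lambda>i. i < p \<and> p \<le> i + k) [0..<k]"

lemma circ_dist_le_hamming_cycle_code:
  assumes "p \<le> q" "q \<le> 2 * k"
  shows "min (q - p) (2 * k - (q - p)) \<le> hamming_dist (cycle_code k p) (cycle_code k q)"
proof -
  let ?S = "{i. i < k \<and> (i < p \<and> p \<le> i + k) \<noteq> (i < q \<and> q \<le> i + k)}"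
  have S: "hamming_dist (cycle_code k p) (cycle_code k q) = card ?S"
    unfolding hamming_dist_def cycle_code_def by (auto intro!: arg_cong[where f = card])
  have le: "card A \<le> card ?S" if "A \<subseteq> ?S" for A
    using that by (intro card_mono) auto
  \<comment> \<open>Both positions lie in the first half, they lie in different halves at distance
    at least \<open>k\<close> or less than \<open>k\<close>, or both lie in the second half. For
    different halves, the first set in the union holds coordinates on only for \<open>p\<close>, the
    second those on only for \<open>q\<close>.\<close>
  consider "q \<le> k" | "p \<le> k" "k < q" "p + k \<le> q" | "p \<le> k" "k < q" "q < p + k" | "k < p"
    by linarith
  then show ?thesis
  proof cases
    case 1
    then have "{p..<q} \<subseteq> ?S" by auto
    from le[OF this] show ?thesis using S by simp
  next
    case 2
    with assms have "{..<p} \<union> {q - k..<k} \<subseteq> ?S" by auto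
    from le[OF this] have "card ({..<p} \<union> {q - k..<k}) \<le> card ?S" .
    moreover have "card ({..<p} \<union> {q - k..<k}) = p + (k - (q - k))"
      using 2 by (subst card_Un_disjoint) auto
    ultimately have "p + (k - (q - k)) \<le> card ?S" by (simp only:)
    then show ?thesis unfolding S using 2 assms by linarith
  next
    case 3
    with assms have "{..<q - k} \<union> {p..<k} \<subseteq> ?S" by auto
    from le[OF this] have "card ({..<q - k} \<union> {p..<k}) \<le> card ?S" .
    moreover have "card ({..<q - k} \<union> {p..<k}) = (q - k) + (k - p)"
      using 3 by (subst card_Un_disjoint) auto
    ultimately have "(q - k) + (k - p) \<le> card ?S" by (simp only:)
    then show ?thesis unfolding S using 3 assms by linarith
  next
    case 4
    with assms have "{p - k..<q - k} \<subseteq> ?S" by auto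
    from le[OF this] show ?thesis using S 4 assms by simp
  qed
qed

lemma hamming_dist_commute:
  assumes "length xs = length ys"
  shows "hamming_dist xs ys = hamming_dist ys xs"
  using assms by (simp add: hamming_dist_def eq_commute)

text \<open>Enlarging the circumference from \<open>W\<close> to \<open>2 * k\<close> never
  decreases circular distances; this accommodates odd \<open>W\<close>.\<close>

lemma circ_dist_le_hamming:
  assumes "p \<le> W" "q \<le> W" "W \<le> 2 * k"
  shows "circ_dist W p q \<le> hamming_dist (cycle_code k p) (cycle_code k q)"
proof -
  have *: "circ_dist W p q \<le> hamming_dist (cycle_code k p) (cycle_code k q)"
    if "p \<le> q" "q \<le> W" for p q
    using circ_dist_le_hamming_cycle_code[of p q k] that assms(3)
    unfolding circ_dist_def by linarith
  have "circ_dist W p q = circ_dist W q p" by (simp add: circ_dist_def add.commute)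
  moreover have "hamming_dist (cycle_code k p) (cycle_code k q) =
      hamming_dist (cycle_code k q) (cycle_code k p)"
    by (rule hamming_dist_commute) (simp add: cycle_code_def)
  ultimately show ?thesis
    using *[of p q] *[of q p] assms by (cases "p \<le> q") auto
qed

section \<open>Distances in weighted cycles\<close>

definition cycle_pos :: "nat \<Rightarrow> (nat set \<Rightarrow> nat) \<Rightarrow> nat \<Rightarrow> nat" where
  "cycle_pos n w i = (\<Sum>j<i. w {j, Suc j mod n})"

lemma cycle_pos_mono: "i \<le> j \<Longrightarrow> cycle_pos n w i \<le> cycle_pos n w j"
  unfolding cycle_pos_def by (intro sum_mono2) auto

lemma cycle_pos_0 [simp]: "cycle_pos n w 0 = 0"
  by (simp add: cycle_pos_def)

lemma cycle_pos_Suc: "cycle_pos n w (Suc i) = cycle_pos n w i + w {i, Suc i mod n}"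
  by (simp add: cycle_pos_def)

lemma cycle_simps [simp]:
  "verts (cycle n w) = {..<n}" "weight (cycle n w) = w"
  by (simp_all add: cycle_def)

lemma edges_cycleI: "i < n \<Longrightarrow> {i, Suc i mod n} \<in> edges (cycle n w)"
  by (auto simp: cycle_def)

abbreviation cycle_dist :: "nat \<Rightarrow> (nat set \<Rightarrow> nat) \<Rightarrow> nat \<Rightarrow> nat \<Rightarrow> nat" where
  "cycle_dist n w u v \<equiv> circ_dist (cycle_pos n w n) (cycle_pos n w u) (cycle_pos n w v)"

lemma circ_dist_0_right: "a \<le> W \<Longrightarrow> circ_dist W a 0 = circ_dist W a W"
  by (auto simp: circ_dist_def)

lemma circ_dist_commute: "circ_dist W a b = circ_dist W b a"
  by (simp add: circ_dist_def add.commute)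

text \<open>Vertex \<open>0\<close> also has position \<open>W\<close>, so the closing edge needs no separate treatment.\<close>

lemma cycle_dist_Suc_mod:
  assumes "i < n" "a \<le> n"
  shows "cycle_dist n w a (Suc i mod n) = cycle_dist n w a (Suc i)"
proof (cases "Suc i = n")
  case True
  then show ?thesis
    using circ_dist_0_right[OF cycle_pos_mono[OF assms(2)]] by simp
qed (use assms in simp)

text \<open>The ends of an edge have positions differing by its weight, once the closing edge is
  taken to end at position \<open>W\<close>.\<close>

lemma edge_dominated_cycle: "edge_dominated (cycle n w) (cycle_dist n w)"
  unfolding edge_dominated_def
proof (intro conjI ballI impI)
  fix u v assume e: "{u, v} \<in> edges (cycle n w)"
  have *: "cycle_dist n w i (Suc i mod n) \<le> w {i, Suc i mod n}" if "i < n" for i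
    using that cycle_dist_Suc_mod[of i n i w]
    by (auto simp: cycle_pos_Suc circ_dist_def)
  obtain i where "i < n" "{u, v} = {i, Suc i mod n}"
    using e by (auto simp: cycle_def)
  with *[of i] show "cycle_dist n w u v \<le> weight (cycle n w) {u, v}"
    by (auto simp: doubleton_eq_iff circ_dist_commute insert_commute)
next
  fix u v x assume "u \<in> verts (cycle n w)" "v \<in> verts (cycle n w)" "x \<in> verts (cycle n w)"
  then show "cycle_dist n w u v \<le> cycle_dist n w u x + cycle_dist n w x v"
    by (intro circ_dist_triangle cycle_pos_mono) auto
qed (simp add: circ_dist_def)

lemma wdist_cycle_le_diff:
  assumes "i \<le> j" "j < n"
  shows "wdist (cycle n w) i j \<le> enat (cycle_pos n w j - cycle_pos n w i)"
  using assms
proof (induction j rule: dec_induct)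
  case base
  then show ?case by (simp add: wdist_self zero_enat_def[symmetric])
next
  case (step j)
  have "wdist (cycle n w) i (Suc j) \<le> wdist (cycle n w) i j + wdist (cycle n w) j (Suc j)"
    by (rule wdist_triangle)
  also have "\<dots> \<le> enat (cycle_pos n w j - cycle_pos n w i) + enat (w {j, Suc j})"
    using step edges_cycleI[of j n w] wdist_edge_le[of j "Suc j" "cycle n w"]
    by (intro add_mono) auto
  also have "\<dots> = enat (cycle_pos n w (Suc j) - cycle_pos n w i)"
    using step cycle_pos_mono[of i j n w] by (simp add: cycle_pos_Suc)
  finally show ?case .
qed

text \<open>Each of the two arcs between \<open>i\<close> and \<open>j\<close> bounds the distance.
  With \<open>edge_dominated_cycle\<close>, \<open>wdist\<close> and \<open>cycle_dist\<close> agree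
  on vertices.\<close>

lemma wdist_cycle_le:
  assumes "i < n" "j < n"
  shows "wdist (cycle n w) i j \<le> enat (cycle_dist n w i j)"
proof -
  let ?p = "cycle_pos n w" and ?d = "wdist (cycle n w)"
  have *: "?d i j \<le> enat (cycle_dist n w i j)" if ij: "i \<le> j" "j < n" for i j
  proof -
    obtain l where l: "n = Suc l" using ij by (cases n) auto
    have mono: "?p i \<le> ?p j" "?p j \<le> ?p l"
      using ij l by (auto intro: cycle_pos_mono)
    \<comment> \<open>The complementary arc runs from \<open>i\<close> down to \<open>0\<close>,
      across the closing edge to the last vertex \<open>l\<close>, and down to
      \<open>j\<close>.\<close>
    have "?d i j \<le> ?d i 0 + (?d 0 l + ?d l j)"
      by (meson add_left_mono order_trans wdist_triangle)
    also have "\<dots> \<le> enat (?p i - ?p 0) + (enat (w {l, 0}) + enat (?p l - ?p j))"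
    proof (intro add_mono)
      show "?d i 0 \<le> enat (?p i - ?p 0)"
        using wdist_cycle_le_diff[of 0 i n w] ij by (subst wdist_commute) simp
      show "?d 0 l \<le> enat (w {l, 0})"
        using edges_cycleI[of l n w] wdist_edge_le[of l 0 "cycle n w"] l
        by (subst wdist_commute) auto
      show "?d l j \<le> enat (?p l - ?p j)"
        using wdist_cycle_le_diff[of j l n w] ij l by (subst wdist_commute) simp
    qed
    also have "\<dots> = enat (?p n - (?p j - ?p i))"
      using mono by (simp add: l cycle_pos_Suc)
    finally show ?thesis
      using wdist_cycle_le_diff[OF ij] mono
      by (simp add: circ_dist_def min_def)
  qed
  show ?thesis
    using *[of i j] *[of j i] assms wdist_commute[of "cycle n w"] circ_dist_commute
    by (metis nat_le_linear)
qed

lemma binary_addressing_cycle: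
  assumes "cycle_pos n w n \<le> 2 * k"
  shows "binary_addressing (cycle n w) k (\<lambda>i. cycle_code k (cycle_pos n w i))"
  unfolding binary_addressing_def
proof (intro conjI ballI)
  fix u v assume uv: "u \<in> verts (cycle n w)" "v \<in> verts (cycle n w)"
  then have "wdist (cycle n w) u v \<le> enat (cycle_dist n w u v)"
    by (simp add: wdist_cycle_le)
  also have "cycle_dist n w u v \<le>
      hamming_dist (cycle_code k (cycle_pos n w u)) (cycle_code k (cycle_pos n w v))"
    using uv assms by (intro circ_dist_le_hamming cycle_pos_mono) auto
  finally show "wdist (cycle n w) u v \<le>
      enat (hamming_dist (cycle_code k (cycle_pos n w u)) (cycle_code k (cycle_pos n w v)))"
    by simp
qed (simp add: cycle_code_def)

text \<open>By weight-minimality an edge weighs no more than its complementary arc.\<close>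

lemma cycle_weight_le_half:
  assumes "weighted_graph (cycle n w)" "i < n"
  shows "2 * w {i, Suc i mod n} \<le> cycle_pos n w n"
proof -
  have "enat (w {i, Suc i mod n}) = wdist (cycle n w) i (Suc i mod n)"
    using assms edges_cycleI[of i n w] unfolding weighted_graph_def by auto
  also have "\<dots> \<le> enat (cycle_dist n w i (Suc i mod n))"
    using assms by (intro wdist_cycle_le) auto
  finally have "w {i, Suc i mod n} \<le> cycle_dist n w i (Suc i)"
    using assms cycle_dist_Suc_mod[of i n i w] by simp
  then show ?thesis
    using cycle_pos_mono[of "Suc i" n n w] assms
    by (auto simp: cycle_pos_Suc circ_dist_def)
qed

text \<open>The arc from \<open>0\<close> is extended for as long as its weight stays at most half of the total.\<close>

lemma cycle_triangle:
  assumes G: "weighted_graph (cycle n w)" and n: "0 < n"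
  obtains a b c where "a < n" "b < n" "c < n"
    "cycle_dist n w a b + cycle_dist n w b c + cycle_dist n w c a = cycle_pos n w n"
proof -
  let ?p = "cycle_pos n w" and ?W = "cycle_pos n w n"
  have "0 < w {0, Suc 0 mod n}"
    using G n edges_cycleI[of 0 n w] unfolding weighted_graph_def by auto
  then have pos: "0 < ?W"
    using cycle_pos_mono[of 1 n n w] n by (simp add: cycle_pos_def)
  \<comment> \<open>The first position past half the circumference; it exists because
    \<open>?W\<close> is positive, so \<open>n\<close> qualifies. The edge from \<open>j\<close> to
    \<open>Suc j\<close> then crosses the halfway point.\<close>
  define k where "k = (LEAST k. ?W < 2 * ?p k)"
  have "?W < 2 * ?p n" using pos by simp
  then have k: "?W < 2 * ?p k" "k \<le> n"
    unfolding k_def by (rule LeastI, rule Least_le)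
  then obtain j where j: "k = Suc j" by (cases k) auto
  have pj: "2 * ?p j \<le> ?W"
    using not_less_Least[of j "\<lambda>k. ?W < 2 * ?p k"] j unfolding k_def by auto
  have jn: "j < n" and le: "?p k \<le> ?W"
    using j k by (auto intro: cycle_pos_mono)
  \<comment> \<open>Now all three arcs weigh at most half: the first by minimality of
    \<open>k\<close>, the crossing edge by weight-minimality, the last because \<open>?p k\<close>
    exceeds half. If \<open>k = n\<close>, the last arc is empty and the third vertex is
    \<open>0\<close> again.\<close>
  have wj: "2 * w {j, Suc j mod n} \<le> ?W"
    by (rule cycle_weight_le_half[OF G jn])
  have "cycle_dist n w 0 j = ?p j"
    using pj by (simp add: circ_dist_def)
  moreover have "cycle_dist n w j (Suc j mod n) = w {j, Suc j mod n}"
    using cycle_dist_Suc_mod[of j n j w] jn wj by (simp add: circ_dist_def cycle_pos_Suc)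
  moreover have "cycle_dist n w (Suc j mod n) 0 = ?W - ?p k"
    using cycle_dist_Suc_mod[of j n 0 w] jn k(1) le
    by (simp add: circ_dist_commute[of _ _ 0] circ_dist_def j)
  moreover have "?p k = ?p j + w {j, Suc j mod n}"
    by (simp add: j cycle_pos_Suc)
  ultimately have "cycle_dist n w 0 j + cycle_dist n w j (Suc j mod n) +
      cycle_dist n w (Suc j mod n) 0 = ?W"
    using le by simp
  then show thesis
    using that[of 0 j "Suc j mod n"] jn n by simp
qed

section \<open>Addressing numbers of cycles and of their product\<close>

lemma addressing_number_eqI:
  assumes "binary_addressing G k f" and "\<And>l f. binary_addressing G l f \<Longrightarrow> k \<le> l"
  shows "addressing_number G = k"
  unfolding addressing_number_def using assms by (intro Least_equality) auto

lemma addressing_number_cycle: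
  assumes G: "weighted_graph (cycle n w)" and n: "0 < n"
  shows "addressing_number (cycle n w) = (cycle_pos n w n + 1) div 2"
proof (rule addressing_number_eqI)
  show "binary_addressing (cycle n w) ((cycle_pos n w n + 1) div 2)
      (\<lambda>i. cycle_code ((cycle_pos n w n + 1) div 2) (cycle_pos n w i))"
    by (rule binary_addressing_cycle) simp
next
  fix l f assume f: "binary_addressing (cycle n w) l f"
  obtain a b c where abc: "a < n" "b < n" "c < n"
    "cycle_dist n w a b + cycle_dist n w b c + cycle_dist n w c a = cycle_pos n w n"
    using cycle_triangle[OF G n] by blast
  have "cycle_pos n w n \<le> 2 * l"
    using binary_addressing_perimeter[OF f edge_dominated_cycle, of a b c] abc by simp
  then show "(cycle_pos n w n + 1) div 2 \<le> l" by simp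
qed

theorem theorem8:
  fixes n m :: nat and w w' :: "nat set \<Rightarrow> nat"
  assumes "n \<ge> 3" and "m \<ge> 3"
    and "weighted_graph (cycle n w)" and "weighted_graph (cycle m w')"
    and "even (\<Sum>i<n. w {i, Suc i mod n}) \<or> even (\<Sum>i<m. w' {i, Suc i mod m})"
  shows "addressing_number (cart_prod (cycle n w) (cycle m w')) =
         addressing_number (cycle n w) + addressing_number (cycle m w')"
proof -
  let ?W = "cycle_pos n w n" and ?W' = "cycle_pos m w' m"
  let ?k = "(?W + 1) div 2" and ?k' = "(?W' + 1) div 2"
  have pos: "0 < n" "0 < m" using assms(1,2) by auto
  have "addressing_number (cart_prod (cycle n w) (cycle m w')) = ?k + ?k'"
  proof (rule addressing_number_eqI)
    show "binary_addressing (cart_prod (cycle n w) (cycle m w')) (?k + ?k')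
        (\<lambda>(i, j). cycle_code ?k (cycle_pos n w i) @ cycle_code ?k' (cycle_pos m w' j))"
      by (intro binary_addressing_cart_prod binary_addressing_cycle assms) simp_all
  next
    fix l f assume f: "binary_addressing (cart_prod (cycle n w) (cycle m w')) l f"
    obtain a b c where abc: "a < n" "b < n" "c < n"
      "cycle_dist n w a b + cycle_dist n w b c + cycle_dist n w c a = ?W"
      using cycle_triangle[OF assms(3) pos(1)] by blast
    obtain x y z where xyz: "x < m" "y < m" "z < m"
      "cycle_dist m w' x y + cycle_dist m w' y z + cycle_dist m w' z x = ?W'"
      using cycle_triangle[OF assms(4) pos(2)] by blast
    \<comment> \<open>The sum of the two circular distances is edge-dominated on the product, so the
      perimeters of the paired triples add up.\<close>
    have "?W + ?W' \<le> 2 * l"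
      using binary_addressing_perimeter[OF f edge_dominated_cart_prod[OF
          edge_dominated_cycle edge_dominated_cycle assms(4)], of "(a, x)" "(b, y)" "(c, z)"]
        abc xyz by simp
    moreover have "even ?W \<or> even ?W'"
      using assms(5) by (simp add: cycle_pos_def)
    moreover have "(W + 1) div 2 + (W' + 1) div 2 \<le> l"
      if "W + W' \<le> 2 * l" "even W \<or> even W'" for W W' :: nat
      using that by presburger
    ultimately show "?k + ?k' \<le> l" by blast
  qed
  then show ?thesis
    using assms(3,4) pos by (simp add: addressing_number_cycle)
qed

end
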